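(* Let $\mathsf{x}^*=\sum_{j\in\mathcal{J}}x_j^*\mathbf{e}_j\in\mathbb{R}^n$, where $\mathcal{J}=\mathrm{supp}(\mathsf{x}^* )$, let $\mathcal{J}^c=\{1,\dots,n\}\setminus\mathcal{J}$, and assume that $$\mathsf{A}\mathbf{e}_i\neq\eta\,\mathsf{A}\mathbf{e}_j\quad\forall i,j\in\{1,\dots,n\},\ i\neq j,\ \forall\eta\in\mathbb{R}.$$ If $$\mathrm{supp}(\mathsf{P}\mathbf{e}_j)\cap\mathrm{supp}(\mathsf{P}\mathbf{e}_k)=\emptyset\quad\text{for all } j,k\in\mathcal{J},\ j\neq k,$$ then there exist real numbers $(a_j)_{j\in\mathcal{J}}$ such that $$\Big[\sum_{j\in\mathcal{J}}a_j\mathsf{W}^{-1}\mathsf{P}\mathbf{e}_j\Big]_i=\mathrm{sgn}(x_i^* )\quad\forall i\in\mathcal{J},\qquad \Big[\sum_{j\in\mathcal{J}}a_j\mathsf{W}^{-1}\mathsf{P}\mathbf{e}_j\Big]_i\in(-1,1)\quad\forall i\in\mathcal{J}^c.$$ Furthermore, with these $a_j$, the vector $$\mathbf{y}_\alpha^*=\sum_{j\in\mathcal{J}}(x_j^*-\alpha a_j)\mathbf{e}_j$$ solves $$\min_{\mathbf{x}\in\mathbb{R}^n}\left\{\frac12\|\mathsf{P}\mathbf{x}-\mathsf{P}\mathsf{x}^*\|_2^2+\alpha\|\mathsf{W}\mathbf{x}\|_1\right\},$$ provided that $\alpha>0$ is chosen such that $\mathrm{sgn}(x_j^*-\alpha a_j)=\mathrm{sgn}(x_j^*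 )$ for all $j\in\mathcal{J}$.
   Context: $\mathsf{A}\in\mathbb{R}^{m\times n}$ is a matrix with nontrivial null space $\mathcal{N}(\mathsf{A})$, $\mathsf{A}^\dagger$ is its Moore-Penrose pseudo-inverse, and $\mathsf{P}=\mathsf{A}^\dagger\mathsf{A}$ is the orthogonal projection of $\mathbb{R}^n$ onto $\mathcal{N}(\mathsf{A})^\perp$. $\mathbf{e}_1,\dots,\mathbf{e}_n$ are the standard basis vectors of $\mathbb{R}^n$, and it is assumed that $\mathsf{P}\mathbf{e}_i\neq 0$ for all $i$. $\mathsf{W}\in\mathbb{R}^{n\times n}$ is the (invertible) diagonal matrix defined by $\mathsf{W}\mathbf{e}_i=\|\mathsf{P}\mathbf{e}_i\|_2\,\mathbf{e}_i$. $[\mathbf{v}]_i$ is the $i$-th component of $\mathbf{v}$; $\mathrm{supp}(\mathbf{v})=\{i: v_i\neq 0\}$. *)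

theory Defs
  imports "HOL-Analysis.Analysis"
begin

definition supp :: "real ^ 'n \<Rightarrow> 'n set" where
  "supp v = {i. v $ i \<noteq> 0}"

definition l1_norm :: "real ^ 'n \<Rightarrow> real" where
  "l1_norm v = (\<Sum>i\<in>UNIV. \<bar>v $ i\<bar>)"

definition is_pinv :: "real ^ 'n ^ 'm \<Rightarrow> real ^ 'm ^ 'n \<Rightarrow> bool" where
  "is_pinv A X \<longleftrightarrow>
     A ** X ** A = A \<and> X ** A ** X = X \<and>
     transpose (A ** X) = A ** X \<and> transpose (X ** A) = X ** A"

text \<open>
  The Moore-Penrose pseudo-inverse, specified by the four Penrose equations; the lemma
  \<open>ex1_is_pinv\<close> below shows that the description operator is well-defined here.
\<close>
definition pinv :: "real ^ 'n ^ 'm \<Rightarrow> real ^ 'm ^ 'n" where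
  "pinv A = (THE X. is_pinv A X)"

lemma is_pinv_unique:
  fixes A :: "real ^ 'n ^ 'm"
  assumes "is_pinv A X" "is_pinv A Y"
  shows "X = Y"
proof -
  have X: "A ** X ** A = A" "X ** A ** X = X" "transpose (A ** X) = A ** X" "transpose (X ** A) = X ** A"
    and Y: "A ** Y ** A = A" "Y ** A ** Y = Y" "transpose (A ** Y) = A ** Y" "transpose (Y ** A) = Y ** A"
    using assms by (auto simp: is_pinv_def)
  have "A ** X = (A ** Y) ** (A ** X)"
    using Y(1) by (simp add: matrix_mul_assoc)
  also have "\<dots> = transpose ((A ** X) ** (A ** Y))"
    using X(3) Y(3) by (simp add: matrix_transpose_mul)
  also have "\<dots> = A ** Y"
    using X(1) Y(3) by (simp add: matrix_mul_assoc)
  finally have AX: "A ** X = A ** Y" .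
  have "X ** A = (X ** A) ** (Y ** A)"
    using Y(1) by (metis matrix_mul_assoc)
  also have "\<dots> = transpose ((Y ** A) ** (X ** A))"
    using X(4) Y(4) by (simp add: matrix_transpose_mul)
  also have "\<dots> = Y ** A"
    using X(1) Y(4) by (metis matrix_mul_assoc)
  finally have XA: "X ** A = Y ** A" .
  show "X = Y"
    by (metis X(2) Y(2) AX XA matrix_mul_assoc)
qed

lemma ex_orthogonal_projection:
  fixes S :: "(real ^ 'n) set"
  assumes S: "subspace S"
  obtains p :: "real ^ 'n \<Rightarrow> real ^ 'n" where
    "linear p" "\<And>x. p x \<in> S" "\<And>x. x \<in> S \<Longrightarrow> p x = x"
    "\<And>x y. p x \<bullet> y = x \<bullet> p y"
proof -
  obtain B where B: "B \<subseteq> S" "pairwise orthogonal B" "\<And>x. x \<in> B \<Longrightarrow> norm x = 1"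
    "independent B" "span B = S"
    using orthonormal_basis_subspace[OF S] by metis
  have fin: "finite B"
    using B(4) by (simp add: finiteI_independent)
  define p where "p = (\<lambda>x. \<Sum>b\<in>B. (x \<bullet> b) *\<^sub>R b)"
  have lin: "linear p"
    unfolding p_def
    by (rule linearI) (simp_all add: inner_add_left scaleR_add_left sum.distrib scaleR_sum_right)
  have inS: "p x \<in> S" for x
    unfolding p_def using B(1) S by (meson subspace_scale subspace_sum subsetD)
  have sa: "p x \<bullet> y = x \<bullet> p y" for x y
    unfolding p_def by (simp add: inner_sum_left inner_sum_right inner_commute mult.commute)
  have pb: "p b = b" if "b \<in> B" for b
  proof -
    have "p b = (\<Sum>c\<in>B. if c = b then b else 0)"
      unfolding p_def
    proof (rule sum.cong[OF refl])
      fix c assume "c \<in> B"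
      show "(b \<bullet> c) *\<^sub>R c = (if c = b then b else 0)"
        using B(2) B(3)[OF that] \<open>c \<in> B\<close> that
        by (auto simp: pairwise_def orthogonal_def norm_eq_1)
    qed
    then show ?thesis using fin that by simp
  qed
  have fixS: "p x = x" if "x \<in> S" for x
    using linear_eq_on_span[OF lin linear_id[unfolded id_def], of B x] pb that B(5) by simp
  with lin inS fixS sa that show ?thesis by blast
qed

lemma symmetric_matrix_of_selfadjoint:
  fixes f :: "real ^ 'n \<Rightarrow> real ^ 'n"
  assumes "\<And>x y. f x \<bullet> y = x \<bullet> f y"
  shows "transpose (matrix f) = matrix f"
proof -
  have "matrix f $ j $ i = matrix f $ i $ j" for i j
    using assms[of "axis i 1" "axis j 1"]
    by (simp add: matrix_def inner_axis inner_axis' inner_commute)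
  then show ?thesis by (simp add: transpose_def vec_eq_iff)
qed

lemma ex_is_pinv:
  fixes A :: "real ^ 'n ^ 'm"
  shows "\<exists>X. is_pinv A X"
proof -
  define N where "N = {x. A *v x = 0}"
  define R where "R = range (\<lambda>x. A *v x)"
  have linA: "linear (\<lambda>x. A *v x)" by simp
  have "subspace N"
    unfolding N_def using linear_subspace_kernel[OF linA] by simp
  then obtain q where q: "linear q" "\<And>x. q x \<in> N" "\<And>x. x \<in> N \<Longrightarrow> q x = x"
    "\<And>x y. q x \<bullet> y = x \<bullet> q y"
    by (rule ex_orthogonal_projection) blast
  have "subspace R"
    unfolding R_def using linear_subspace_image[OF linA subspace_UNIV] .
  then obtain r where r: "linear r" "\<And>x. r x \<in> R" "\<And>x. x \<in> R \<Longrightarrow> r x = x"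
    "\<And>x y. r x \<bullet> y = x \<bullet> r y"
    by (rule ex_orthogonal_projection) blast
  define p where "p = (\<lambda>x. x - q x)"
  have linp: "linear p"
    unfolding p_def using linear_compose_sub[OF linear_id[unfolded id_def] q(1)] .
  have Ap: "A *v p x = A *v x" for x
    using q(2)[of x] by (simp add: p_def N_def matrix_vector_mult_diff_distrib)
  have pp: "p (p x) = p x" for x
    using q(3)[OF q(2)] by (simp add: p_def linear_diff[OF q(1)])
  have psa: "p x \<bullet> y = x \<bullet> p y" for x y
    using q(4) by (simp add: p_def inner_diff_left inner_diff_right)
  have subp: "subspace (range p)"
    using linear_subspace_image[OF linp subspace_UNIV] .
  have inj: "inj_on (\<lambda>x. A *v x) (range p)"
  proof (rule inj_onI)
    fix u v assume uv: "u \<in> range p" "v \<in> range p" "A *v u = A *v v"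
    then have "u - v \<in> N" by (simp add: N_def matrix_vector_mult_diff_distrib)
    then have "q (u - v) = u - v" by (rule q(3))
    then have "p (u - v) = 0" by (simp add: p_def)
    then show "u = v" using uv(1,2) pp by (auto simp: linear_diff[OF linp])
  qed
  obtain g where g: "linear g" "\<And>x. x \<in> range p \<Longrightarrow> g (A *v x) = x"
    using linear_exists_left_inverse_on[OF linA subp inj] by blast
  have gA: "g (A *v x) = p x" for x
    using g(2)[of "p x"] Ap by simp
  define X where "X = matrix (g \<circ> r)"
  have X: "X *v y = g (r y)" for y
    unfolding X_def using linear_compose[OF r(1) g(1)] by (simp add: matrix_works linear_matrix_vector_mul_eq)
  have XA: "X *v (A *v x) = p x" for x
    using r(3)[of "A *v x"] gA by (simp add: X R_def)
  have AX: "A *v (X *v y) = r y" for y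
    using r(2)[of y] by (auto simp: X R_def gA Ap)
  have mXA: "X ** A = matrix p"
    by (simp add: matrix_eq matrix_works linear_matrix_vector_mul_eq linp XA flip: matrix_vector_mul_assoc)
  have mAX: "A ** X = matrix r"
    by (simp add: matrix_eq matrix_works linear_matrix_vector_mul_eq r(1) AX flip: matrix_vector_mul_assoc)
  have "is_pinv A X"
    unfolding is_pinv_def
  proof (intro conjI)
    show "A ** X ** A = A"
      by (simp add: matrix_eq XA Ap flip: matrix_vector_mul_assoc)
    show "X ** A ** X = X"
    proof -
      have "X *v r y = X *v y" for y
        using r(3)[OF r(2)] by (simp add: X)
      then show ?thesis
        by (simp add: matrix_eq AX matrix_mul_assoc[symmetric] flip: matrix_vector_mul_assoc)
    qed
    show "transpose (A ** X) = A ** X"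
      using symmetric_matrix_of_selfadjoint[of r] r(4) mAX by simp
    show "transpose (X ** A) = X ** A"
      using symmetric_matrix_of_selfadjoint[of p] psa mXA by simp
  qed
  then show ?thesis ..
qed

lemma ex1_is_pinv: "\<exists>!X. is_pinv A X"
  using ex_is_pinv is_pinv_unique by blast

lemma is_pinv_pinv: "is_pinv A (pinv A)"
  unfolding pinv_def by (rule theI'[OF ex1_is_pinv])

definition proj_mat :: "real ^ 'n ^ 'm \<Rightarrow> real ^ 'n ^ 'n" where
  "proj_mat A = pinv A ** A"

definition weight_mat :: "real ^ 'n ^ 'm \<Rightarrow> real ^ 'n ^ 'n" where
  "weight_mat A = (\<chi> i j. if i = j then norm (proj_mat A *v axis j 1) else 0)"

end

theory Submission
  imports Defs
begin

text \<open>
  Write \<open>p\<^sub>i = P e\<^sub>i\<close> and \<open>w\<^sub>i = \<parallel>p\<^sub>i\<parallel>\<close>. Since \<open>P\<close> is symmetric and idempotent, its entries are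
  \<open>P\<^sub>i\<^sub>j = p\<^sub>i \<bullet> p\<^sub>j\<close>; in particular \<open>P\<^sub>i\<^sub>i = w\<^sub>i\<^sup>2 > 0\<close>, so every \<open>i\<close> lies in \<open>supp p\<^sub>i\<close>.

  The coefficients are \<open>a\<^sub>j = sgn x\<^sub>j / w\<^sub>j\<close>. The \<open>i\<close>-th entry of \<open>\<Sum>\<^sub>j a\<^sub>j W\<^sup>-\<^sup>1 p\<^sub>j\<close> is then
  \<open>\<Sum>\<^sub>j sgn x\<^sub>j (p\<^sub>i \<bullet> p\<^sub>j) / (w\<^sub>i w\<^sub>j)\<close>, a signed sum of cosines. Disjointness of the supports
  leaves at most one nonzero term. For \<open>i\<close> in \<open>J\<close> it is the one with \<open>j = i\<close>, whose value is
  \<open>sgn x\<^sub>i\<close>. For \<open>i\<close> outside \<open>J\<close> the sum is zero or a single term, up to sign the cosine of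
  the angle between two vectors that are not parallel (a linear relation between \<open>p\<^sub>i\<close> and
  \<open>p\<^sub>j\<close> is mapped by \<open>A\<close> to one between \<open>A e\<^sub>i\<close> and \<open>A e\<^sub>j\<close>), so the strict Cauchy-Schwarz
  inequality applies
  (\<open>abs_projection_entry_less\<close>).

  Optimality is a dual-certificate argument (\<open>certificate_imp_minimizer\<close>): the vector
  \<open>s = W\<^sup>-\<^sup>1 \<Sum>\<^sub>j a\<^sub>j p\<^sub>j\<close> has entries in \<open>[-1, 1]\<close> that agree with the signs of the
  candidate on its support, which makes \<open>\<alpha> W s\<close> a subgradient of \<open>\<alpha> \<parallel>W z\<parallel>\<^sub>1\<close> there. The shift
  by \<open>\<alpha> a\<^sub>j\<close> makes the gradient of the quadratic term equal to \<open>- \<alpha> W s\<close>, so the first-order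
  condition of the convex problem holds.
\<close>

lemma diagonal_matrix_mult_vector_nth:
  fixes d :: "'n::finite \<Rightarrow> real"
  shows "((\<chi> i j. if i = j then d j else 0) *v v) $ i = d i * v $ i"
proof -
  have "(if i = j then d j else 0) * v $ j = (if i = j then d j * v $ j else 0)" for j
    by simp
  then show ?thesis by (simp add: matrix_vector_mult_def)
qed

lemma diagonal_matrix_inv_mult_vector_nth:
  fixes d :: "'n::finite \<Rightarrow> real"
  assumes nz: "\<And>i. d i \<noteq> 0"
  shows "(matrix_inv (\<chi> i j. if i = j then d j else 0) *v v) $ i = v $ i / d i"
proof -
  let ?D = "(\<chi> i j. if i = j then d j else 0) :: real^'n^'n"
  have "inj ((*v) ?D)"
  proof (rule injI)
    fix u v assume "?D *v u = ?D *v v"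
    then have "d k * u $ k = d k * v $ k" for k
      by (simp flip: diagonal_matrix_mult_vector_nth)
    then have "u $ k = v $ k" for k
      using nz by simp
    then show "u = v" by (simp add: vec_eq_iff)
  qed
  then have "invertible ?D"
    by (simp add: invertible_left_inverse matrix_left_invertible_injective)
  then have "?D ** matrix_inv ?D = mat 1"
    unfolding invertible_def matrix_inv_def by (rule someI_ex[THEN conjunct1])
  then have "?D *v (matrix_inv ?D *v v) = v"
    by (simp add: matrix_vector_mul_assoc)
  then have "d i * (matrix_inv ?D *v v) $ i = v $ i"
    by (simp flip: diagonal_matrix_mult_vector_nth)
  then show ?thesis using nz[of i] by (simp add: field_simps)
qed

lemma weight_mat_mult_vector_nth:
  "(weight_mat A *v v) $ i = norm (proj_mat A *v axis i 1) * v $ i"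
  unfolding weight_mat_def by (rule diagonal_matrix_mult_vector_nth)

lemma weight_mat_inv_mult_vector_nth:
  assumes "\<And>i. proj_mat A *v axis i 1 \<noteq> 0"
  shows "(matrix_inv (weight_mat A) *v v) $ i = v $ i / norm (proj_mat A *v axis i 1)"
  unfolding weight_mat_def by (rule diagonal_matrix_inv_mult_vector_nth) (simp add: assms)

lemma transpose_proj_mat: "transpose (proj_mat A) = proj_mat A"
  using is_pinv_pinv[of A] by (simp add: is_pinv_def proj_mat_def)

lemma proj_mat_idem: "proj_mat A *v (proj_mat A *v v) = proj_mat A *v v"
  using is_pinv_pinv[of A]
  by (simp add: is_pinv_def proj_mat_def matrix_vector_mul_assoc matrix_mul_assoc)

lemma mult_proj_mat: "A *v (proj_mat A *v v) = A *v v"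
  using is_pinv_pinv[of A]
  by (simp add: is_pinv_def proj_mat_def matrix_vector_mul_assoc matrix_mul_assoc)

lemma inner_proj_mat: "(proj_mat A *v u) \<bullet> v = u \<bullet> (proj_mat A *v v)"
  by (metis dot_lmul_matrix transpose_matrix_vector transpose_proj_mat)

lemma proj_mat_entry_eq_inner:
  "(proj_mat A *v axis j 1) $ i = (proj_mat A *v axis i 1) \<bullet> (proj_mat A *v axis j 1)"
  by (simp add: inner_proj_mat proj_mat_idem inner_axis')

lemma proj_mat_diagonal_entry: "(proj_mat A *v axis i 1) $ i = (norm (proj_mat A *v axis i 1))\<^sup>2"
  by (simp add: proj_mat_entry_eq_inner[of A i i] power2_norm_eq_inner)

text \<open>
  Equality in the Cauchy-Schwarz inequality for \<open>P e\<^sub>i\<close> and \<open>P e\<^sub>j\<close> would make them proportional,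
  and applying \<open>A\<close>, which satisfies \<open>A P = A\<close>, would then make two columns of \<open>A\<close> proportional.
\<close>
lemma abs_projection_entry_less:
  assumes nz: "proj_mat A *v axis j 1 \<noteq> 0"
    and np: "\<And>\<eta>. A *v axis i 1 \<noteq> \<eta> *\<^sub>R (A *v axis j 1)"
  shows "\<bar>(proj_mat A *v axis j 1) $ i\<bar> < norm (proj_mat A *v axis i 1) * norm (proj_mat A *v axis j 1)"
proof -
  let ?p = "\<lambda>k. proj_mat A *v axis k 1"
  have "\<bar>?p i \<bullet> ?p j\<bar> \<noteq> norm (?p i) * norm (?p j)"
  proof
    assume "\<bar>?p i \<bullet> ?p j\<bar> = norm (?p i) * norm (?p j)"
    then have "collinear {0, ?p j, ?p i}"
      by (simp add: norm_cauchy_schwarz_equal insert_commute)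
    then obtain c where "?p i = c *\<^sub>R ?p j"
      using nz by (auto simp: collinear_lemma)
    then have "A *v ?p i = c *\<^sub>R (A *v ?p j)"
      by (simp add: matrix_vector_mult_scaleR)
    with np show False by (simp add: mult_proj_mat)
  qed
  then show ?thesis
    using Cauchy_Schwarz_ineq2[of "?p i" "?p j"]
    by (simp add: proj_mat_entry_eq_inner[of A j i])
qed

text \<open>
  The first-order optimality condition, with \<open>s\<close> as dual certificate. Writing \<open>u = W s\<close>, the
  residual at \<open>y\<close> is \<open>- \<alpha> u\<close>, so \<open>u\<close> lies in the range of \<open>P\<close> and \<open>P u = u\<close>. Expanding the square around \<open>y\<close> gives the lower
  bound \<open>- \<alpha> u \<bullet> (z - y)\<close> for the increase of the quadratic term, while \<open>\<bar>s\<^sub>i\<bar> \<le> 1\<close> and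
  \<open>s\<^sub>i y\<^sub>i = \<bar>y\<^sub>i\<bar>\<close> give the lower bound \<open>\<alpha> u \<bullet> (z - y)\<close> for that of the penalty.
\<close>
lemma certificate_imp_minimizer:
  fixes A :: "real ^ 'n ^ 'm" and x y s :: "real ^ 'n"
  defines "P \<equiv> proj_mat A" and "W \<equiv> weight_mat A"
  assumes alpha: "\<alpha> > 0"
    and residual: "P *v y - P *v x = - \<alpha> *\<^sub>R (W *v s)"
    and bounded: "\<And>i. \<bar>s $ i\<bar> \<le> 1"
    and aligned: "\<And>i. s $ i * y $ i = \<bar>y $ i\<bar>"
  shows "1/2 * (norm (P *v y - P *v x))\<^sup>2 + \<alpha> * l1_norm (W *v y)
       \<le> 1/2 * (norm (P *v z - P *v x))\<^sup>2 + \<alpha> * l1_norm (W *v z)"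
proof -
  define u where "u = W *v s"
  define w where "w i = norm (P *v axis i 1)" for i
  have w0: "w i \<ge> 0" for i by (simp add: w_def)
  have Wn: "(W *v v) $ i = w i * v $ i" for v i
    by (simp add: W_def P_def w_def weight_mat_mult_vector_nth)
  have l1: "l1_norm (W *v v) = (\<Sum>i\<in>UNIV. w i * \<bar>v $ i\<bar>)" for v
    by (simp add: l1_norm_def Wn abs_mult w0)
  have uv: "u \<bullet> v = (\<Sum>i\<in>UNIV. w i * (s $ i * v $ i))" for v
    by (simp add: inner_vec_def u_def Wn mult.assoc)
  have res: "P *v y - P *v x = - \<alpha> *\<^sub>R u" using residual by (simp add: u_def)
  have "(- \<alpha>) *\<^sub>R u = P *v ((- \<alpha>) *\<^sub>R u)"
    unfolding res[symmetric] by (simp add: P_def proj_mat_idem matrix_vector_mult_diff_distrib)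
  then have Pu: "P *v u = u"
    using alpha by (simp add: matrix_vector_mult_scaleR del: scaleR_minus_left)
  have "u \<bullet> z \<le> l1_norm (W *v z)"
  proof -
    have "s $ i * z $ i \<le> \<bar>z $ i\<bar>" for i
    proof -
      have "s $ i * z $ i \<le> \<bar>s $ i\<bar> * \<bar>z $ i\<bar>" by (metis abs_ge_self abs_mult)
      also have "\<dots> \<le> \<bar>z $ i\<bar>" by (simp add: bounded mult_left_le_one_le)
      finally show ?thesis .
    qed
    then show ?thesis unfolding uv l1 by (intro sum_mono mult_left_mono w0)
  qed
  then have pen: "\<alpha> * (u \<bullet> z) \<le> \<alpha> * l1_norm (W *v z)"
    using alpha by simp
  have peny: "l1_norm (W *v y) = u \<bullet> y"
    by (simp add: uv l1 aligned)
  define h where "h = P *v (z - y)"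
  have "u \<bullet> h = u \<bullet> (z - y)"
    using inner_proj_mat[of A u "z - y"] Pu by (simp add: h_def P_def)
  then have uh: "\<alpha> * (u \<bullet> h) = \<alpha> * (u \<bullet> z) - \<alpha> * (u \<bullet> y)"
    by (simp add: inner_diff_right right_diff_distrib)
  have split: "P *v z - P *v x = - \<alpha> *\<^sub>R u + h"
    by (simp only: res[symmetric] h_def matrix_vector_mult_diff_distrib) simp
  have "(norm (P *v z - P *v x))\<^sup>2 = (norm (P *v y - P *v x))\<^sup>2 - 2 * (\<alpha> * (u \<bullet> h)) + (norm h)\<^sup>2"
    unfolding split res by (simp add: power2_norm_eq_inner algebra_simps inner_commute)
      (simp add: power2_eq_square)
  then have "(norm (P *v z - P *v x))\<^sup>2
      \<ge> (norm (P *v y - P *v x))\<^sup>2 - 2 * (\<alpha> * (u \<bullet> z) - \<alpha> * (u \<bullet> y))"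
    by (simp add: uh)
  with pen show ?thesis by (simp add: peny)
qed

theorem corollary4p7p1:
  fixes A :: "real ^ 'n ^ 'm" and P W :: "real ^ 'n ^ 'n"
    and x :: "real ^ 'n" and J :: "'n set"
  assumes null_space: "{z. A *v z = 0} \<noteq> {0}"
    and P: "P = proj_mat A"
    and W: "W = weight_mat A"
    and P_nonzero: "\<And>i. P *v axis i 1 \<noteq> 0"
    and J: "J = supp x"
    and not_parallel: "\<And>i j \<eta>. i \<noteq> j \<Longrightarrow> A *v axis i 1 \<noteq> \<eta> *\<^sub>R (A *v axis j 1)"
    and disjoint: "\<And>j k. j \<in> J \<Longrightarrow> k \<in> J \<Longrightarrow> j \<noteq> k \<Longrightarrow>
      supp (P *v axis j 1) \<inter> supp (P *v axis k 1) = {}"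
  shows "\<exists>a :: 'n \<Rightarrow> real.
    (\<forall>i\<in>J. (\<Sum>j\<in>J. a j *\<^sub>R (matrix_inv W *v (P *v axis j 1))) $ i = sgn (x $ i)) \<and>
    (\<forall>i\<in>- J. (\<Sum>j\<in>J. a j *\<^sub>R (matrix_inv W *v (P *v axis j 1))) $ i \<in> {-1<..<1}) \<and>
    (\<forall>\<alpha>>0. (\<forall>j\<in>J. sgn (x $ j - \<alpha> * a j) = sgn (x $ j)) \<longrightarrow>
      is_arg_min (\<lambda>z. 1/2 * (norm (P *v z - P *v x))\<^sup>2 + \<alpha> * l1_norm (W *v z))
        (\<lambda>z. z \<in> UNIV) (\<Sum>j\<in>J. (x $ j - \<alpha> * a j) *\<^sub>R axis j 1))"
proof -
  define p where "p j = P *v axis j 1" for j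
  define w where "w j = norm (p j)" for j
  define a where "a j = sgn (x $ j) / w j" for j
  define s where "s = (\<Sum>j\<in>J. a j *\<^sub>R (matrix_inv W *v p j))"
  have wpos: "w j > 0" for j using P_nonzero by (simp add: w_def p_def)
  have diag: "p i $ i = (w i)\<^sup>2" for i
    by (simp add: p_def w_def P proj_mat_diagonal_entry)
  have winv: "(matrix_inv W *v v) $ i = v $ i / w i" for v i
    using weight_mat_inv_mult_vector_nth[of A v i] P_nonzero by (simp add: P W w_def p_def)
  have s_nth: "s $ i = (\<Sum>j\<in>J. a j * p j $ i / w i)" for i
    by (simp add: s_def winv)
  have collapse: "s $ i = a j * p j $ i / w i" if j: "j \<in> J" "i \<in> supp (p j)" for i j
  proof -
    have "p k $ i = 0" if "k \<in> J" "k \<noteq> j" for k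
      using disjoint[OF j(1) that(1)] that(2) j(2) by (auto simp: p_def supp_def)
    then have "s $ i = (\<Sum>k\<in>{j}. a k * p k $ i / w i)"
      unfolding s_nth using j(1) by (intro sum.mono_neutral_right) auto
    then show ?thesis by simp
  qed
  have on: "s $ i = sgn (x $ i)" if "i \<in> J" for i
  proof -
    have "i \<in> supp (p i)" using wpos[of i] by (simp add: supp_def diag)
    from collapse[OF that this] show ?thesis
      using wpos[of i] by (simp add: diag a_def power2_eq_square)
  qed
  have off: "\<bar>s $ i\<bar> < 1" if i: "i \<notin> J" for i
  proof (cases "\<exists>j\<in>J. i \<in> supp (p j)")
    case True
    then obtain j where j: "j \<in> J" "i \<in> supp (p j)" by blast
    have "i \<noteq> j" using i j(1) by blast
    then have "\<bar>p j $ i\<bar> < w i * w j"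
      using abs_projection_entry_less[of A j i] P_nonzero not_parallel by (simp add: P p_def w_def)
    moreover have "\<bar>sgn (x $ j)\<bar> = 1" using j(1) by (simp add: J supp_def abs_sgn_eq)
    ultimately show ?thesis
      using wpos[of i] wpos[of j]
      by (simp add: collapse[OF j] a_def abs_mult field_simps)
  next
    case False
    then have "s $ i = 0" unfolding s_nth by (intro sum.neutral) (auto simp: supp_def)
    then show ?thesis by simp
  qed
  have optimal: "is_arg_min (\<lambda>z. 1/2 * (norm (P *v z - P *v x))\<^sup>2 + \<alpha> * l1_norm (W *v z))
      (\<lambda>z. z \<in> UNIV) (\<Sum>j\<in>J. (x $ j - \<alpha> * a j) *\<^sub>R axis j 1)"
    if alpha: "\<alpha> > 0" and signs: "\<forall>j\<in>J. sgn (x $ j - \<alpha> * a j) = sgn (x $ j)" for \<alpha>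
  proof -
    define y :: "real ^ 'n" where "y = (\<Sum>j\<in>J. (x $ j - \<alpha> * a j) *\<^sub>R axis j 1)"
    \<comment> \<open>This also holds outside \<open>J\<close>: there \<open>x $ i = 0\<close>, and \<open>a i = 0\<close> because \<open>sgn 0 = 0\<close>.\<close>
    have y_nth: "y $ i = x $ i - \<alpha> * a i" for i
    proof -
      have "y $ i = (\<Sum>j\<in>J. if j = i then x $ j - \<alpha> * a j else 0)"
        unfolding y_def sum_component by (rule sum.cong) (auto simp: axis_def)
      also have "\<dots> = x $ i - \<alpha> * a i" by (simp add: J supp_def a_def)
      finally show ?thesis .
    qed
    have Ws: "W *v s = (\<Sum>j\<in>J. a j *\<^sub>R p j)"
    proof -
      have "(W *v s) $ i = (\<Sum>j\<in>J. a j *\<^sub>R p j) $ i" for i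
      proof -
        have "(W *v s) $ i = w i * s $ i"
          by (simp add: W P w_def p_def weight_mat_mult_vector_nth)
        also have "\<dots> = (\<Sum>j\<in>J. a j * p j $ i)"
          unfolding s_nth sum_distrib_left using wpos[of i] by simp
        finally show ?thesis by simp
      qed
      then show ?thesis by (simp add: vec_eq_iff)
    qed
    have "y - x = - \<alpha> *\<^sub>R (\<Sum>j\<in>J. a j *\<^sub>R axis j 1)"
    proof -
      have "(\<Sum>j\<in>J. a j *\<^sub>R axis j (1::real)) $ i = a i" for i
      proof -
        have "(\<Sum>j\<in>J. a j *\<^sub>R axis j (1::real)) $ i = (\<Sum>j\<in>J. if j = i then a j else 0)"
          unfolding sum_component by (rule sum.cong) (auto simp: axis_def)
        also have "\<dots> = a i" by (simp add: J supp_def a_def)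
        finally show ?thesis .
      qed
      then show ?thesis by (simp add: vec_eq_iff y_nth)
    qed
    then have "P *v (y - x) = - \<alpha> *\<^sub>R (W *v s)"
      by (simp add: Ws p_def matrix_vector_mult_scaleR linear_sum[OF matrix_vector_mul_linear]
          linear_neg[OF matrix_vector_mul_linear])
    then have residual: "P *v y - P *v x = - \<alpha> *\<^sub>R (W *v s)"
      by (simp add: matrix_vector_mult_diff_distrib)
    have bounded: "\<bar>s $ i\<bar> \<le> 1" for i
      using on[of i] off[of i] by (cases "i \<in> J") (auto simp: abs_sgn_eq)
    have aligned: "s $ i * y $ i = \<bar>y $ i\<bar>" for i
    proof (cases "i \<in> J")
      case True
      then have "s $ i = sgn (y $ i)" using on signs by (simp add: y_nth)
      then show ?thesis by (simp add: abs_sgn mult.commute)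
    next
      case False
      then show ?thesis by (simp add: y_nth J supp_def a_def)
    qed
    show ?thesis
      using certificate_imp_minimizer[OF alpha residual[unfolded P W] bounded aligned]
      by (simp add: is_arg_min_def not_less P W flip: y_def)
  qed
  show ?thesis
  proof (intro exI[of _ a] conjI ballI allI impI)
    fix i assume "i \<in> - J"
    then show "(\<Sum>j\<in>J. a j *\<^sub>R (matrix_inv W *v (P *v axis j 1))) $ i \<in> {-1<..<1}"
      using off[of i] unfolding s_def p_def by (simp add: abs_less_iff del: sum_component)
  qed (use on optimal in \<open>auto simp: s_def p_def\<close>)
qed

end
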